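(* Consider the scalar-transport model $$\frac{\partial c}{\partial t} + \nabla\cdot(u c + \phi u_r c) = \nabla \cdot \left[D \left\{\nabla c - \frac{(1 - \phi)\, n\, c}{\epsilon} \right\}\right],$$ with spatial operators discretized by a central-difference scheme, and let $c_i^k$ and $\phi_i^k$ denote the discrete values of $c$ and $\phi$, where $k$ is the time-step index and $i$ is the grid index. If $\phi^k_i$ is bounded between $0$ and $1$ for all $k\in\mathbb{Z}^+$ and for all $i$, on a uniform one-dimensional grid, then $c^k_i\ge 0$ holds for all $k\in\mathbb{Z}^+$, provided $$ \Delta x \le \frac{2 D}{|u|_{\mathrm{max}} + |u_r|_{\mathrm{max}} + \frac{D}{\epsilon}} \qquad\text{and}\qquad \Delta t \le \frac{\Delta x^2}{2D} $$ are satisfied, where $\Delta x$ is the grid-cell size, $\Delta t$ is the time-step size, and $|u|_{\mathrm{max}}$ and $|u_r|_{\mathrm{max}}$ are the maximum fluid velocity and the maximum relative velocity of the scalar in the domain, respectively.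
   Context: Here $c$ is the concentration of a scalar (amount of scalar per unit total volume) confined to one phase of a two-phase flow, $\phi$ is the phase-field variable (volume fraction) of that phase, $u$ is the fluid velocity, $u_r$ is the velocity of the scalar relative to the fluid, $D$ is the diffusivity of the scalar, $\epsilon$ is the interface thickness parameter, and $n=\nabla\phi/|\nabla\phi|$ is the unit normal to the interface. The result is presented as a sufficient condition for the model to maintain the positivity of the scalar concentration field at all times during the simulation. For the time discretization, the paper remarks that a first-order Euler time-stepping scheme was used in the proof to arrive at the restriction on $\Delta t$; the discrete equation written in the proof is $$ \begin{aligned} c^{k+1}_i = c^k_i &+ \Delta t \left[- \frac{u^k_{i+1}c^k_{i+1} - u^k_{i-1}c^k_{i-1}}{2\Delta x} -\frac{u^k_{r,i+1}\phi^k_{i+1}c^k_{i+1} - u^k_{r,i-1}\phi^k_{i-1}c^k_{i-1}}{2\Delta x} \right] \\ &+ \Delta t \left[D\,\frac{c_{i+1}^k -2c_{i}^k + c_{i-1}^k}{\Delta x^2} - \frac{D}{\epsilon}\,\frac{(1 - \phi_{i+1}^k) n_{i+1}^k c_{i+1}^k - (1 - \phi_{i-1}^k) n_{i-1}^k c_{i-1}^k}{2\Delta x} \right]. \end{aligned} $$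
   Formalization: The formal statement assumes that the initial concentration is nonnegative and that the phase field also lies between 0 and 1 at the initial time step; without these assumptions the claim is false (for example, a constant negative initial concentration stays negative). *)

theory Defs
  imports Complex_Main
begin

text \<open>Grid functions on the uniform one-dimensional grid have type \<open>int \<Rightarrow> real\<close>; discrete fields have
  type \<open>nat \<Rightarrow> int \<Rightarrow> real\<close>, with the time-step index first. No boundary condition is
  imposed; a finite grid with periodic boundary conditions is the special case of fields that are
  periodic in the grid index.\<close>

definition central_diff :: "real \<Rightarrow> (int \<Rightarrow> real) \<Rightarrow> int \<Rightarrow> real" where
  "central_diff dx f i = (f (i + 1) - f (i - 1)) / (2 * dx)"

definition central_diff2 :: "real \<Rightarrow> (int \<Rightarrow> real) \<Rightarrow> int \<Rightarrow> real" where
  "central_diff2 dx f i = (f (i + 1) - 2 * f i + f (i - 1)) / dx\<^sup>2"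

text \<open>The interface normal is the normalized discrete gradient of the phase field. The quotient is
  undefined where that gradient vanishes; there any value of modulus at most one is
  admitted, so that every convention for the degenerate case (such as 0) is covered.\<close>

definition interface_normal ::
  "real \<Rightarrow> (nat \<Rightarrow> int \<Rightarrow> real) \<Rightarrow> (nat \<Rightarrow> int \<Rightarrow> real) \<Rightarrow> bool" where
  "interface_normal dx \<phi> n \<longleftrightarrow>
     (\<forall>k i. if central_diff dx (\<phi> k) i \<noteq> 0
            then n k i = central_diff dx (\<phi> k) i / \<bar>central_diff dx (\<phi> k) i\<bar>
            else \<bar>n k i\<bar> \<le> 1)"

text \<open>First-order (explicit) Euler time stepping and central differences in space for the
  transport model with constant diffusivity: the first bracket is the advective
  flux divergence, the second the diffusive and interface-confining flux divergence. The
  diffusion term uses the compact three-point second difference, not the composition of two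
  first differences.\<close>

definition scalar_transport_scheme ::
  "real \<Rightarrow> real \<Rightarrow> real \<Rightarrow> real \<Rightarrow> (nat \<Rightarrow> int \<Rightarrow> real) \<Rightarrow> (nat \<Rightarrow> int \<Rightarrow> real) \<Rightarrow>
   (nat \<Rightarrow> int \<Rightarrow> real) \<Rightarrow> (nat \<Rightarrow> int \<Rightarrow> real) \<Rightarrow> (nat \<Rightarrow> int \<Rightarrow> real) \<Rightarrow> bool" where
  "scalar_transport_scheme dx dt D \<epsilon> u ur \<phi> n c \<longleftrightarrow>
     (\<forall>k i. c (Suc k) i = c k i
        + dt * (- central_diff dx (\<lambda>j. u k j * c k j) i
                - central_diff dx (\<lambda>j. ur k j * \<phi> k j * c k j) i)
        + dt * (D * central_diff2 dx (c k) i
                - D / \<epsilon> * central_diff dx (\<lambda>j. (1 - \<phi> k j) * n k j * c k j) i))"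

text \<open>The supremum of the modulus over all time steps and grid points. It is meaningful only for
  bounded fields: \<open>Sup\<close> of an unbounded set of reals is unspecified.\<close>

definition bounded_field :: "(nat \<Rightarrow> int \<Rightarrow> real) \<Rightarrow> bool" where
  "bounded_field v \<longleftrightarrow> bdd_above {\<bar>v k i\<bar> | k i. True}"

definition max_abs :: "(nat \<Rightarrow> int \<Rightarrow> real) \<Rightarrow> real" where
  "max_abs v = Sup {\<bar>v k i\<bar> | k i. True}"

end

theory Submission
  imports Defs
begin

text \<open>With the total speed \<open>a = u + \<phi> u\<^sub>r + (D / \<epsilon>) (1 - \<phi>) n\<close>, one Euler step expresses the new
  value at \<open>i\<close> as a linear combination of the old values at \<open>i\<close> and \<open>i \<plusminus> 1\<close>, with weights
  \<open>1 - 2 D \<Delta>t / \<Delta>x\<^sup>2\<close> and \<open>\<Delta>t (D / \<Delta>x\<^sup>2 \<mp> a\<^bsub>i\<plusminus>1\<^esub> / (2 \<Delta>x))\<close>. The time-step restriction makes the first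
  weight nonnegative; the grid restriction says that the cell Peclet number \<open>\<bar>a\<bar> \<Delta>x / D\<close> is at
  most 2, which makes the other two nonnegative.\<close>

lemma abs_le_max_abs:
  assumes "bounded_field v"
  shows "\<bar>v k i\<bar> \<le> max_abs v"
  using assms unfolding bounded_field_def max_abs_def by (intro cSup_upper) auto

lemma interface_normal_abs_le_1:
  assumes "interface_normal dx \<phi> n"
  shows "\<bar>n k i\<bar> \<le> 1"
proof (cases "central_diff dx (\<phi> k) i = 0")
  case True
  then show ?thesis
    using assms by (auto simp: interface_normal_def)
next
  case False
  then have "n k i = central_diff dx (\<phi> k) i / \<bar>central_diff dx (\<phi> k) i\<bar>"
    using assms by (auto simp: interface_normal_def)
  then show ?thesis
    by (simp add: abs_divide)
qed

text \<open>The confining flux is linear in \<open>c\<close> and contains no derivative of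
  \<open>c\<close>, so it acts as one more advection velocity.\<close>

definition total_speed :: "real \<Rightarrow> real \<Rightarrow> (nat \<Rightarrow> int \<Rightarrow> real) \<Rightarrow> (nat \<Rightarrow> int \<Rightarrow> real) \<Rightarrow>
    (nat \<Rightarrow> int \<Rightarrow> real) \<Rightarrow> (nat \<Rightarrow> int \<Rightarrow> real) \<Rightarrow> nat \<Rightarrow> int \<Rightarrow> real" where
  "total_speed D \<epsilon> u ur \<phi> n k i = u k i + ur k i * \<phi> k i + D / \<epsilon> * ((1 - \<phi> k i) * n k i)"

text \<open>Bounding \<open>\<phi>\<close>, \<open>1 - \<phi>\<close> and
  \<open>\<bar>n\<bar>\<close> separately by 1 yields exactly the denominator of the grid
  restriction.\<close>

lemma abs_total_speed_le:
  assumes "D \<ge> 0" and "\<epsilon> \<ge> 0"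
    and "bounded_field u" and "bounded_field ur"
    and "interface_normal dx \<phi> n"
    and "0 \<le> \<phi> k i" and "\<phi> k i \<le> 1"
  shows "\<bar>total_speed D \<epsilon> u ur \<phi> n k i\<bar> \<le> max_abs u + max_abs ur + D / \<epsilon>"
proof -
  have "\<bar>ur k i * \<phi> k i\<bar> \<le> max_abs ur * 1"
    unfolding abs_mult using assms abs_le_max_abs[OF \<open>bounded_field ur\<close>, of k i]
    by (intro mult_mono) auto
  moreover have "\<bar>(1 - \<phi> k i) * n k i\<bar> \<le> 1 * 1"
    unfolding abs_mult using assms interface_normal_abs_le_1[OF \<open>interface_normal dx \<phi> n\<close>, of k i]
    by (intro mult_mono) auto
  then have "\<bar>D / \<epsilon> * ((1 - \<phi> k i) * n k i)\<bar> \<le> D / \<epsilon> * 1"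
    unfolding abs_mult[of "D / \<epsilon>"] using assms by (intro mult_mono) auto
  moreover have "\<bar>u k i\<bar> \<le> max_abs u"
    using abs_le_max_abs assms by blast
  ultimately show ?thesis
    unfolding total_speed_def by linarith
qed

text \<open>Central first differences skip the centre point, so only diffusion enters the weight at
  \<open>i\<close>, and speeds enter only the neighbour weights.\<close>

lemma scalar_transport_scheme_weights:
  assumes "scalar_transport_scheme dx dt D \<epsilon> u ur \<phi> n c"
  defines "a \<equiv> total_speed D \<epsilon> u ur \<phi> n"
  shows "c (Suc k) i = (1 - dt * (2 * D / dx\<^sup>2)) * c k i
    + dt * (D / dx\<^sup>2 - a k (i + 1) / (2 * dx)) * c k (i + 1)
    + dt * (D / dx\<^sup>2 + a k (i - 1) / (2 * dx)) * c k (i - 1)"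
proof -
  have "c (Suc k) i = c k i
      + dt * (- central_diff dx (\<lambda>j. u k j * c k j) i
              - central_diff dx (\<lambda>j. ur k j * \<phi> k j * c k j) i)
      + dt * (D * central_diff2 dx (c k) i
              - D / \<epsilon> * central_diff dx (\<lambda>j. (1 - \<phi> k j) * n k j * c k j) i)"
    using assms(1) unfolding scalar_transport_scheme_def by blast
  then show ?thesis
    unfolding a_def total_speed_def central_diff_def central_diff2_def
    by (simp add: add_divide_distrib diff_divide_distrib algebra_simps)
qed

lemma abs_speed_le_diffusion:
  fixes a dx D :: real
  assumes "dx > 0" and "\<bar>a\<bar> * dx \<le> 2 * D"
  shows "\<bar>a / (2 * dx)\<bar> \<le> D / dx\<^sup>2"
proof -
  have "\<bar>a / (2 * dx)\<bar> = \<bar>a\<bar> * dx / (2 * dx\<^sup>2)"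
    using assms by (simp add: field_simps power2_eq_square)
  also have "\<dots> \<le> 2 * D / (2 * dx\<^sup>2)"
    using assms by (intro divide_right_mono) auto
  finally show ?thesis by simp
qed

theorem theorem5p1:
  fixes dx dt D \<epsilon> :: real
    and u ur \<phi> n c :: "nat \<Rightarrow> int \<Rightarrow> real"
  assumes "dx > 0" and "dt > 0" and "D > 0" and "\<epsilon> > 0"
    and "bounded_field u" and "bounded_field ur"
    and "interface_normal dx \<phi> n"
    and "scalar_transport_scheme dx dt D \<epsilon> u ur \<phi> n c"
    and "\<And>i. c 0 i \<ge> 0"
    and "\<And>k i. 0 \<le> \<phi> k i \<and> \<phi> k i \<le> 1"
    and "dx \<le> 2 * D / (max_abs u + max_abs ur + D / \<epsilon>)"
    and "dt \<le> dx\<^sup>2 / (2 * D)"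
  shows "\<forall>k i. c k i \<ge> 0"
proof -
  define S where "S = max_abs u + max_abs ur + D / \<epsilon>"
  define a where "a = total_speed D \<epsilon> u ur \<phi> n"
  \<comment> \<open>This term makes \<open>S\<close> strictly positive even if both velocities
    vanish, so the denominator of the grid restriction can be cleared. Any grid point shows that the
    two maxima are nonnegative.\<close>
  have "D / \<epsilon> > 0"
    using assms by simp
  then have "S > 0"
    using abs_le_max_abs[OF assms(5), of 0 0] abs_le_max_abs[OF assms(6), of 0 0]
    unfolding S_def by linarith
  then have S: "S * dx \<le> 2 * D"
    using assms(11) unfolding S_def[symmetric] by (simp add: field_simps)
  have a: "\<bar>a k i / (2 * dx)\<bar> \<le> D / dx\<^sup>2" for k i
  proof (rule abs_speed_le_diffusion[OF \<open>dx > 0\<close>])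
    have "\<bar>a k i\<bar> \<le> S"
      unfolding a_def S_def using abs_total_speed_le assms by simp
    then show "\<bar>a k i\<bar> * dx \<le> 2 * D"
      using S mult_right_mono[of "\<bar>a k i\<bar>" S dx] \<open>dx > 0\<close> by linarith
  qed
  have time: "1 - dt * (2 * D / dx\<^sup>2) \<ge> 0"
    using assms by (simp add: field_simps)
  have "c k i \<ge> 0" for k i
  \<comment> \<open>The index \<open>i\<close> must vary, since the step uses nonnegativity at both
    neighbours.\<close>
  proof (induction k arbitrary: i)
    case 0
    then show ?case using assms by simp
  next
    case (Suc k)
    \<comment> \<open>The bound on the modulus covers both signs of \<open>a\<close>, hence any flow
      direction.\<close>
    have "D / dx\<^sup>2 - a k (i + 1) / (2 * dx) \<ge> 0" and "D / dx\<^sup>2 + a k (i - 1) / (2 * dx) \<ge> 0"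
      using a[of k "i + 1"] a[of k "i - 1"] by linarith+
    then show ?case
      unfolding scalar_transport_scheme_weights[OF assms(8), of k i] a_def[symmetric]
      using Suc.IH[of i] Suc.IH[of "i + 1"] Suc.IH[of "i - 1"] time \<open>dt > 0\<close>
      by (metis add_nonneg_nonneg mult_nonneg_nonneg less_imp_le)
  qed
  then show ?thesis by blast
qed

end
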